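(* Let $p$ be an odd prime, let $H$ be a nontrivial subgroup of $\mathbb{F}_p^\times$, and suppose that $A$ and $B$ are nonempty $H$-closed subsets of $\mathbb{F}_p$ with $0\notin A$, $0\notin B$, and $0\notin A+B$. Then $|A|+|B|\leq p-1$, and $|A+B|\geq|A|+|B|$.
   Context: $\mathbb{F}_p=\mathbb{Z}/p\mathbb{Z}$ and $A+B=\{a+b:a\in A,b\in B\}$. A subset $A\subseteq\mathbb{F}_p$ is $H$-closed if $ha\in A$ for all $h\in H$, $a\in A$. *)

theory Defs
  imports "HOL-Number_Theory.Residues" "HOL-Algebra.Coset"
begin

definition H_closed :: "('a, 'b) ring_scheme \<Rightarrow> 'a set \<Rightarrow> 'a set \<Rightarrow> bool" where
  "H_closed R H A \<longleftrightarrow> A \<subseteq> carrier R \<and> (\<forall>h\<in>H. \<forall>a\<in>A. h \<otimes>\<^bsub>R\<^esub> a \<in> A)"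

abbreviation GFp :: "nat \<Rightarrow> int ring" where
  "GFp p \<equiv> residue_ring (int p)"

end

theory Submission
  imports Defs "HOL-Algebra.Multiplicative_Group"
begin

text \<open>
  The Cauchy--Davenport inequality already gives \<open>|A + B| \<ge> |A| + |B| - 1\<close>. Since none of \<open>A\<close>, \<open>B\<close>
  and \<open>A + B\<close> contains \<open>0\<close>, each of them is a union of cosets of \<open>H\<close> in the group of units, so \<open>|H|\<close>
  divides all three cardinalities. Equality would make \<open>|H|\<close> divide \<open>1\<close>.
\<close>

text \<open>By Lagrange a nonidentity \<open>d\<close> generates a group of prime order, so the
  elements \<open>d [^] n \<otimes> a\<close> of \<open>A\<close> already exhaust the group.
  Contraposed, every such \<open>d\<close> moves some element of a nonempty proper subset out of
  it.\<close>

lemma (in group) prime_order_mult_closed: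
  assumes prime: "prime (order G)"
    and "A \<subseteq> carrier G" and "A \<noteq> {}"
    and "d \<in> carrier G" and "d \<noteq> \<one>"
    and closed: "\<And>a. a \<in> A \<Longrightarrow> d \<otimes> a \<in> A"
  shows "A = carrier G"
proof -
  have fin: "finite (carrier G)"
    using prime_gt_0_nat[OF prime] by (simp add: order_gt_0_iff_finite)
  obtain a where a: "a \<in> A" "a \<in> carrier G" using assms by blast
  have pow: "d [^] n \<otimes> a \<in> A" for n :: nat
  proof (induction n)
    case 0
    then show ?case using a by simp
  next
    case (Suc n)
    have "d [^] Suc n \<otimes> a = d \<otimes> (d [^] n \<otimes> a)"
      using a \<open>d \<in> carrier G\<close> by (metis m_assoc nat_pow_Suc2 nat_pow_closed)
    then show ?case using closed[OF Suc] by simp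
  qed
  have "ord d dvd order G" using \<open>d \<in> carrier G\<close> ord_dvd_group_order by blast
  moreover have "ord d \<noteq> 1" using \<open>d \<in> carrier G\<close> \<open>d \<noteq> \<one>\<close> ord_eq_1 by blast
  ultimately have "ord d = order G" using prime by (auto simp: prime_nat_iff)
  then have "card (generate G {d}) = card (carrier G)"
    using generate_pow_card[OF \<open>d \<in> carrier G\<close>] by (simp add: order_def)
  then have gen: "generate G {d} = carrier G"
    using card_subset_eq[OF fin generate_incl] \<open>d \<in> carrier G\<close> by simp
  have "x \<in> A" if x: "x \<in> carrier G" for x
  proof -
    have "x \<otimes> inv a \<in> generate G {d}" using gen x a by simp
    \<comment> \<open>Natural exponents suffice because \<open>ord d\<close> is positive.\<close>
    then obtain n :: nat where "x \<otimes> inv a = d [^] n"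
      using generate_pow_nat[OF \<open>d \<in> carrier G\<close>] \<open>ord d = order G\<close> prime_gt_0_nat[OF prime] by auto
    then have "d [^] n \<otimes> a = x" using x a by (metis inv_closed l_inv m_assoc r_one)
    then show ?thesis using pow[of n] by simp
  qed
  then show ?thesis using assms by blast
qed

text \<open>Induction on \<open>card B\<close> with \<open>A\<close> arbitrary: unless
  \<open>B\<close> is a singleton or \<open>A\<close> is everything, the pair is replaced by one
  with the same total cardinality, a smaller nonempty second set, and a product set inside
  \<open>A <#> B\<close>. The multiplicative form applies later to the additive group of the
  field.\<close>

theorem (in comm_group) cauchy_davenport:
  assumes prime: "prime (order G)"
    and "A \<subseteq> carrier G" and "B \<subseteq> carrier G" and "A \<noteq> {}" and "B \<noteq> {}"
  shows "min (order G) (card A + card B - 1) \<le> card (A <#> B)"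
  using assms(2-5)
proof (induction "card B" arbitrary: A B rule: less_induct)
  case less
  have fin: "finite (carrier G)"
    using prime_gt_0_nat[OF prime] by (simp add: order_gt_0_iff_finite)
  have finA: "finite A" and finB: "finite B"
    using less.prems fin finite_subset by blast+
  have sub: "A <#> B \<subseteq> carrier G" using less.prems set_mult_closed by blast
  then have finAB: "finite (A <#> B)" using fin finite_subset by blast
  obtain b where b: "b \<in> B" "b \<in> carrier G" using less.prems by blast
  \<comment> \<open>One translate of \<open>A\<close> inside the product set settles both base
    cases.\<close>
  have "(\<lambda>a. a \<otimes> b) ` A \<subseteq> A <#> B" using b by (auto simp: set_mult_def)
  moreover have "inj_on (\<lambda>a. a \<otimes> b) A"
    using inj_on_multc[OF b(2)] less.prems(1) by (rule inj_on_subset)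
  ultimately have cardA: "card A \<le> card (A <#> B)"
    using card_mono[OF finAB] by (metis card_image)
  consider "card B = 1" | "A = carrier G" | "card B \<noteq> 1" "A \<noteq> carrier G" by blast
  then show ?case
  proof cases
    case 1
    then show ?thesis using cardA by simp
  next
    case 2
    then show ?thesis using cardA by (simp add: order_def)
  next
    case 3
    have "B \<noteq> {b}" using 3 by auto
    then obtain c where c: "c \<in> B" "c \<noteq> b" "c \<in> carrier G" using b less.prems by blast
    \<comment> \<open>Two distinct elements of \<open>B\<close> have a nontrivial quotient, which
      cannot preserve the proper subset \<open>A\<close>; the \<open>a\<close> it moves out of
      \<open>A\<close> determines the transform.\<close>
    have "c \<otimes> inv b \<noteq> \<one>" using b c by (metis inv_closed inv_equality inv_inv)
    then have "\<exists>a\<in>A. c \<otimes> inv b \<otimes> a \<notin> A"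
      using prime_order_mult_closed[OF prime less.prems(1,3), of "c \<otimes> inv b"] 3 b c by auto
    then obtain a where a: "a \<in> A" "a \<in> carrier G" "c \<otimes> inv b \<otimes> a \<notin> A"
      using less.prems by blast
    \<comment> \<open>Dyson's transform: moving part of the translate \<open>e B\<close> into \<open>A\<close> keeps the total cardinality.\<close>
    define e where "e = a \<otimes> inv b"
    have e: "e \<in> carrier G" "e \<otimes> b = a" "e \<otimes> c = c \<otimes> inv b \<otimes> a"
      using a b c by (auto simp: e_def m_ac)
    define T where "T = (\<lambda>x. e \<otimes> x) ` B"
    define B' where "B' = {x \<in> B. e \<otimes> x \<in> A}"
    have inj: "inj_on (\<lambda>x. e \<otimes> x) B"
      using inj_on_cmult[OF e(1)] less.prems(2) by (rule inj_on_subset)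
    have T: "T \<subseteq> carrier G" "card T = card B"
      using e less.prems card_image[OF inj] by (auto simp: T_def)
    \<comment> \<open>The elements kept in \<open>B'\<close> correspond to the overlap of
      \<open>A\<close> and \<open>T\<close>, so inclusion-exclusion preserves the total.\<close>
    have "A \<inter> T = (\<lambda>x. e \<otimes> x) ` B'" by (auto simp: T_def B'_def)
    then have "card (A \<inter> T) = card B'"
      using card_image inj_on_subset[OF inj, of B'] by (auto simp: B'_def)
    then have sum: "card (A \<union> T) + card B' = card A + card B"
      using card_Un_Int[OF finA, of T] T finite_subset[OF T(1) fin] by simp
    \<comment> \<open>Here the choice of \<open>e\<close> pays off: \<open>e \<otimes> b = a\<close>
      lies in \<open>A\<close>, so \<open>B'\<close> is nonempty, while \<open>e \<otimes> c\<close>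
      does not, so \<open>B'\<close> is strictly smaller than \<open>B\<close>.\<close>
    have "b \<in> B'" "c \<notin> B'" "B' \<subseteq> B" using a b e by (auto simp: B'_def)
    then have "card B' < card B" using c finB by (metis psubsetI psubset_card_mono)
    then have IH: "min (order G) (card (A \<union> T) + card B' - 1) \<le> card ((A \<union> T) <#> B')"
      using less.hyps[of B' "A \<union> T"] less.prems T \<open>b \<in> B'\<close> \<open>B' \<subseteq> B\<close> by blast
    have "(A \<union> T) <#> B' \<subseteq> A <#> B"
    proof
      fix x assume "x \<in> (A \<union> T) <#> B'"
      then obtain t y where ty: "t \<in> A \<union> T" "y \<in> B'" "x = t \<otimes> y"
        by (auto simp: set_mult_def)
      show "x \<in> A <#> B"
      proof (cases "t \<in> A")
        case True
        then show ?thesis using ty by (auto simp: set_mult_def B'_def)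
      next
        case False
        then obtain z where z: "z \<in> B" "t = e \<otimes> z" using ty by (auto simp: T_def)
        \<comment> \<open>Commutativity lets \<open>e\<close> pass from \<open>z\<close> to
          \<open>y\<close>, and \<open>e \<otimes> y\<close> is in \<open>A\<close> because
          \<open>y\<close> is in \<open>B'\<close>.\<close>
        then have "x = (e \<otimes> y) \<otimes> z"
          using ty e less.prems by (auto simp: B'_def m_ac subset_iff)
        then show ?thesis using ty z by (auto simp: set_mult_def B'_def)
      qed
    qed
    then have "card ((A \<union> T) <#> B') \<le> card (A <#> B)" by (rule card_mono[OF finAB])
    then show ?thesis using IH sum by simp
  qed
qed

text \<open>Closure under \<open>H\<close> makes \<open>A\<close> a disjoint union of right cosets
  of \<open>H\<close>, all of size \<open>card H\<close>.\<close>

lemma (in group) card_subgroup_dvd_card_closed: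
  assumes H: "subgroup H G" and "finite A" and A: "A \<subseteq> carrier G"
    and closed: "\<And>h a. h \<in> H \<Longrightarrow> a \<in> A \<Longrightarrow> h \<otimes> a \<in> A"
  shows "card H dvd card A"
proof -
  define C where "C = (\<lambda>a. H #> a) ` A"
  have C: "C \<subseteq> rcosets H" using A by (auto simp: C_def RCOSETS_def)
  have "H #> a \<subseteq> A" if "a \<in> A" for a
    using closed that by (auto simp: r_coset_def)
  moreover have "a \<in> H #> a" if "a \<in> A" for a
    using that A rcos_self[OF _ H] by blast
  ultimately have Un: "\<Union>C = A"
    unfolding C_def by blast
  have "card H * card C = card (\<Union>C)"
  proof (rule card_partition)
    show "finite C" using \<open>finite A\<close> by (simp add: C_def)
    show "finite (\<Union>C)" using \<open>finite A\<close> Un by simp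
    show "card c = card H" if "c \<in> C" for c
      using that C card_rcosets_equal[of c H] subgroup.subset[OF H] by (metis subsetD)
    show "c \<inter> d = {}" if "c \<in> C" "d \<in> C" "c \<noteq> d" for c d
      using that C rcos_disjoint[OF H] by (auto simp: pairwise_def disjnt_def)
  qed
  then show ?thesis using Un by (metis dvd_triv_left)
qed

theorem theorem5p7:
  fixes p :: nat and H A B :: "int set"
  assumes "prime p" and "odd p"
    and "subgroup H (units_of (GFp p))" and "H \<noteq> {\<one>\<^bsub>GFp p\<^esub>}"
    and "A \<noteq> {}" and "B \<noteq> {}"
    and "H_closed (GFp p) H A" and "H_closed (GFp p) H B"
    and "\<zero>\<^bsub>GFp p\<^esub> \<notin> A" and "\<zero>\<^bsub>GFp p\<^esub> \<notin> B"
    and "\<zero>\<^bsub>GFp p\<^esub> \<notin> A <+>\<^bsub>GFp p\<^esub> B"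
  shows "card A + card B \<le> p - 1 \<and> card (A <+>\<^bsub>GFp p\<^esub> B) \<ge> card A + card B"
proof -
  interpret residues_prime p "GFp p"
    by unfold_locales (use assms(1) in simp_all)
  let ?R = "GFp p" and ?U = "units_of (GFp p)"
  let ?S = "A <+>\<^bsub>?R\<^esub> B"
  interpret U: comm_group ?U by (rule units_comm_group)
  have A: "A \<subseteq> carrier ?R" and B: "B \<subseteq> carrier ?R"
    using assms(7,8) by (auto simp: H_closed_def)
  have S: "?S \<subseteq> carrier ?R" using A B by (rule set_add_closed)
  have S_iff: "x \<in> ?S \<longleftrightarrow> (\<exists>a\<in>A. \<exists>b\<in>B. x = a \<oplus>\<^bsub>?R\<^esub> b)" for x
    by (auto simp: set_add_def set_mult_def)
  have fin: "finite (carrier ?R)" by simp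
  have card_R: "card (carrier ?R) = p" by (simp add: res_carrier_eq)
  have finA: "finite A" and finB: "finite B" and finS: "finite ?S"
    using A B S fin finite_subset by blast+
  have bound: "card A + card B \<le> p - 1"
  proof -
    \<comment> \<open>Since \<open>0\<close> is not a sum, \<open>A\<close> is disjoint from the set
      of negatives of \<open>B\<close>; both lie among the \<open>p - 1\<close> nonzero
      residues.\<close>
    define N where "N = (\<lambda>b. \<ominus>\<^bsub>?R\<^esub> b) ` B"
    have "inj_on (\<lambda>b. \<ominus>\<^bsub>?R\<^esub> b) B"
      using B by (metis (no_types, lifting) inj_onI minus_minus subsetD)
    then have "card N = card B" by (simp add: N_def card_image)
    moreover have "A \<inter> N = {}"
    proof -
      have "\<ominus>\<^bsub>?R\<^esub> b \<notin> A" if "b \<in> B" for b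
        using that B assms(11) S_iff l_neg by (metis subsetD)
      then show ?thesis by (auto simp: N_def)
    qed
    moreover have "A \<union> N \<subseteq> carrier ?R - {\<zero>\<^bsub>?R\<^esub>}"
    proof -
      have "\<ominus>\<^bsub>?R\<^esub> b \<noteq> \<zero>\<^bsub>?R\<^esub>" if "b \<in> B" for b
        using that B assms(10) by (metis minus_minus minus_zero subsetD)
      then show ?thesis using A B assms(9) by (auto simp: N_def)
    qed
    then have "card (A \<union> N) \<le> p - 1"
      using card_mono[of "carrier ?R - {\<zero>\<^bsub>?R\<^esub>}" "A \<union> N"] fin card_R by simp
    ultimately show ?thesis
      using card_Un_disjoint[OF finA, of N] finB by (simp add: N_def)
  qed
  have order: "order (add_monoid ?R) = p" using card_R by (simp add: order_def)
  have "min p (card A + card B - 1) \<le> card ?S"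
    using comm_group.cauchy_davenport[OF a_comm_group, of A B] order assms(1,5,6) A B
    by (simp add: set_add_def)
  \<comment> \<open>The bound just proved keeps \<open>card A + card B - 1\<close> below
    \<open>p\<close>, so the minimum is not \<open>p\<close>.\<close>
  then have CD: "card A + card B - 1 \<le> card ?S" using bound by simp
  have U_carrier: "carrier ?U = carrier ?R - {\<zero>\<^bsub>?R\<^esub>}"
    using field_Units by (simp add: units_of_carrier)
  \<comment> \<open>Avoiding zero places \<open>X\<close> inside the unit group, where the coset
    count applies.\<close>
  have dvd: "card H dvd card X" if X: "H_closed ?R H X" "\<zero>\<^bsub>?R\<^esub> \<notin> X" for X
  proof (rule U.card_subgroup_dvd_card_closed[OF assms(3)])
    show "X \<subseteq> carrier ?U" using X U_carrier by (auto simp: H_closed_def)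
    show "finite X" using X fin finite_subset by (auto simp: H_closed_def)
    show "h \<otimes>\<^bsub>?U\<^esub> a \<in> X" if "h \<in> H" "a \<in> X" for h a
      using that X by (simp add: H_closed_def units_of_mult)
  qed
  have HR: "H \<subseteq> carrier ?R"
    using subgroup.subset[OF assms(3)] U_carrier by auto
  have S_closed: "H_closed ?R H ?S"
    unfolding H_closed_def
  proof (intro conjI ballI)
    show "?S \<subseteq> carrier ?R" by (fact S)
    fix h s assume h: "h \<in> H" and "s \<in> ?S"
    then obtain a b where ab: "a \<in> A" "b \<in> B" "s = a \<oplus>\<^bsub>?R\<^esub> b" using S_iff by blast
    then have "h \<otimes>\<^bsub>?R\<^esub> s = h \<otimes>\<^bsub>?R\<^esub> a \<oplus>\<^bsub>?R\<^esub> h \<otimes>\<^bsub>?R\<^esub> b"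
      using r_distr A B HR h by (metis subsetD)
    moreover have "h \<otimes>\<^bsub>?R\<^esub> a \<in> A" "h \<otimes>\<^bsub>?R\<^esub> b \<in> B"
      using assms(7,8) h ab by (auto simp: H_closed_def)
    ultimately show "h \<otimes>\<^bsub>?R\<^esub> s \<in> ?S" using S_iff by blast
  qed
  have "card H \<noteq> 1"
  proof
    assume "card H = 1"
    then obtain x where "H = {x}" using card_1_singletonE by blast
    then show False
      using subgroup.one_closed[OF assms(3)] assms(4) by (simp add: units_of_one)
  qed
  moreover have "card H dvd card A + card B" "card H dvd card ?S"
    using dvd assms(7-11) S_closed by auto
  moreover have "card A > 0" using assms(5) finA by (simp add: card_gt_0_iff)
  \<comment> \<open>Otherwise \<open>card H\<close> would divide two consecutive numbers, hence
    \<open>1\<close>. Positivity of \<open>card A\<close> ensures that the subtraction does not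
    truncate.\<close>
  ultimately have "card ?S \<noteq> card A + card B - 1"
    by (metis One_nat_def Suc_pred add.commute add_gr_0 dvd_add_right_iff nat_dvd_1_iff_1 plus_1_eq_Suc)
  then show ?thesis using CD bound by linarith
qed

end
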